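(* Let $\mathbf{M}=(M,d)$ be an ultrametric space, let $n$ be a non-negative integer and let $F,F'$ be two $n$-element subsets of $M$. A map $\varphi:F\to F'$ extends to a surjective isometry $\overline{\varphi}$ of $\mathbf{M}$ if and only if for all $x,y\in F$ the restriction $\varphi_{\restriction\{x,y\}}$ extends to a surjective isometry of $\mathbf{M}$.
   Context: A metric space $\mathbf{M}=(M,d)$ is ultrametric if $d(x,z)\le\max\{d(x,y),d(y,z)\}$ for all $x,y,z\in M$. A surjective isometry of $\mathbf{M}$ is a distance-preserving map of $M$ onto $M$. The elements $x,y\in F$ are not required to be distinct. *)

theory Defs
  imports "HOL-Analysis.Abstract_Metric_Spaces"
begin

locale Ultrametric_space = Metric_space M d
  for M :: "'a set" and d :: "'a \<Rightarrow> 'a \<Rightarrow> real" +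
  assumes ultrametric: "\<lbrakk>x \<in> M; y \<in> M; z \<in> M\<rbrakk> \<Longrightarrow> d x z \<le> max (d x y) (d y z)"

definition surjective_isometry :: "'a set \<Rightarrow> ('a \<Rightarrow> 'a \<Rightarrow> real) \<Rightarrow> ('a \<Rightarrow> 'a) \<Rightarrow> bool" where
  "surjective_isometry M d f \<longleftrightarrow> f ` M = M \<and> (\<forall>x\<in>M. \<forall>y\<in>M. d (f x) (f y) = d x y)"

(* Partial maps are total functions together with an explicit domain A: only the values of
   \<phi> on A matter, so taking A to be a smaller set expresses restriction of \<phi>. *)
definition extends_to_surjective_isometry ::
    "'a set \<Rightarrow> ('a \<Rightarrow> 'a \<Rightarrow> real) \<Rightarrow> 'a set \<Rightarrow> ('a \<Rightarrow> 'a) \<Rightarrow> bool" where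
  "extends_to_surjective_isometry M d A \<phi> \<longleftrightarrow>
     (\<exists>\<psi>. surjective_isometry M d \<psi> \<and> (\<forall>x\<in>A. \<psi> x = \<phi> x))"

end

(* Induct on F. After composing with the inverse of an extension of \<phi> to G, the map fixes G
   pointwise and moves x to x', and for every g in G some surjective isometry fixes g and moves x
   to x'. Take g in G nearest to x, with r = d x g: the open r-balls around x and x' miss G, and
   d x x' \<le> r. Cutting the isometry down to these two balls, where it acts as an exchange (or as a
   permutation, if the balls coincide), and taking the identity elsewhere, gives a surjective
   isometry, since all distances between different pieces are at least r. *)

theory Submission
  imports Defs
begin

lemma surjective_isometry_mem: "surjective_isometry M d f \<Longrightarrow> x \<in> M \<Longrightarrow> f x \<in> M"
  unfolding surjective_isometry_def by blast

lemma surjective_isometry_dist: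
  "surjective_isometry M d f \<Longrightarrow> x \<in> M \<Longrightarrow> y \<in> M \<Longrightarrow> d (f x) (f y) = d x y"
  unfolding surjective_isometry_def by blast

lemma surjective_isometry_comp:
  assumes "surjective_isometry M d f" and "surjective_isometry M d g"
  shows "surjective_isometry M d (f \<circ> g)"
  unfolding surjective_isometry_def
proof (intro conjI ballI)
  show "(f \<circ> g) ` M = M"
    using assms unfolding surjective_isometry_def by (metis image_comp)
  show "d ((f \<circ> g) x) ((f \<circ> g) y) = d x y" if "x \<in> M" "y \<in> M" for x y
    using that assms by (simp add: surjective_isometry_mem surjective_isometry_dist)
qed

text \<open>Distance 0 characterises equality, so preserving distances forces injectivity on
  \<open>M\<close>; hence \<open>inv_into M f\<close> is a two-sided inverse there.\<close>

lemma (in Metric_space) surjective_isometry_inverse: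
  assumes f: "surjective_isometry M d f"
  obtains g where "surjective_isometry M d g"
    and "\<And>x. x \<in> M \<Longrightarrow> g (f x) = x" and "\<And>x. x \<in> M \<Longrightarrow> f (g x) = x"
proof
  let ?g = "inv_into M f"
  have "inj_on f M"
    by (rule inj_onI) (metis f surjective_isometry_dist zero)
  then show left: "?g (f x) = x" if "x \<in> M" for x
    using that by simp
  have im: "f ` M = M"
    using f by (simp add: surjective_isometry_def)
  then show right: "f (?g x) = x" if "x \<in> M" for x
    using that by (simp add: f_inv_into_f)
  have mem: "?g x \<in> M" if "x \<in> M" for x
    using that im by (simp add: inv_into_into)
  have "?g ` M = M"
    using mem left surjective_isometry_mem[OF f] by force
  moreover have "d (?g x) (?g y) = d x y" if "x \<in> M" "y \<in> M" for x y
    using surjective_isometry_dist[OF f mem mem] right that by metis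
  ultimately show "surjective_isometry M d ?g"
    by (simp add: surjective_isometry_def)
qed

context Ultrametric_space
begin

lemma dist_less_trans:
  "d x y < r \<Longrightarrow> d y z < r \<Longrightarrow> x \<in> M \<Longrightarrow> y \<in> M \<Longrightarrow> z \<in> M \<Longrightarrow> d x z < r"
  using ultrametric[of x y z] by linarith

text \<open>Along the chain \<open>x'\<close>, \<open>x\<close>, \<open>y\<close>, \<open>y'\<close>
  no step exceeds \<open>d x y\<close>. Used in both directions, this shows that small displacements
  do not change large distances.\<close>

lemma dist_le_of_displacement_le:
  assumes "x \<in> M" "y \<in> M" "x' \<in> M" "y' \<in> M"
    and "d x x' \<le> r" "d y y' \<le> r" "r \<le> d x y"
  shows "d x' y' \<le> d x y"
  using ultrametric[of x' x y'] ultrametric[of x y y'] assms commute[of x x'] by linarith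

lemma surjective_isometry_moving_balls:
  assumes f: "surjective_isometry M d f" and x: "x \<in> M" and r: "0 < r" and near: "d x (f x) \<le> r"
  obtains h where "surjective_isometry M d h" and "h x = f x"
    and "\<And>y. r \<le> d x y \<Longrightarrow> r \<le> d (f x) y \<Longrightarrow> h y = y"
proof -
  obtain g where g: "surjective_isometry M d g"
    and gf: "\<And>x. x \<in> M \<Longrightarrow> g (f x) = x" and fg: "\<And>x. x \<in> M \<Longrightarrow> f (g x) = x"
    using surjective_isometry_inverse[OF f] by blast
  \<comment> \<open>The order of the tests covers both configurations: if the balls coincide, the
    second branch is never reached and \<open>f\<close> permutes the ball; if they are disjoint,
    \<open>f\<close> and its inverse \<open>g\<close> exchange them.\<close>
  define h where "h y = (if d x y < r then f y else if d (f x) y < r then g y else y)" for y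
  note fM = surjective_isometry_mem[OF f] and gM = surjective_isometry_mem[OF g]
  note fd = surjective_isometry_dist[OF f] and gd = surjective_isometry_dist[OF g]
  have fx: "f x \<in> M" using fM x .
  have f_ball: "d (f x) (f y) = d x y" if "y \<in> M" for y
    using fd x that .
  have g_ball: "d x (g y) = d (f x) y" if "y \<in> M" for y
    using gd[OF fx that] gf[OF x] by simp
  have balls_eq: "d x y < r \<longleftrightarrow> d (f x) y < r"
    if "y \<in> M" "z \<in> M" "d x z < r" "d (f x) z < r" for y z
    using that x fx dist_less_trans commute by metis
  have hM: "h y \<in> M" if "y \<in> M" for y
    using that fM gM by (simp add: h_def)
  have displacement: "d y (h y) \<le> r" if y: "y \<in> M" for y
  proof -
    have near': "d (f x) x \<le> r" using near commute by metis
    consider "d x y < r" | "\<not> d x y < r" "d (f x) y < r" | "\<not> d x y < r" "\<not> d (f x) y < r"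
      by blast
    then show ?thesis
    proof cases
      case 1
      \<comment> \<open>The route passes through both centres; its last leg has length
        \<open>d x y\<close> because \<open>f\<close> is an isometry.\<close>
      have "d y (f y) \<le> max (d y x) (max (d x (f x)) (d (f x) (f y)))"
        using ultrametric[OF y x fM[OF y]] ultrametric[OF x fx fM[OF y]] by linarith
      then show ?thesis
        using 1 near f_ball[OF y] commute[of y x] by (simp add: h_def)
    next
      case 2
      have "d y (g y) \<le> max (d y (f x)) (max (d (f x) x) (d x (g y)))"
        using ultrametric[OF y fx gM[OF y]] ultrametric[OF fx x gM[OF y]] by linarith
      then show ?thesis
        using 2 near' g_ball[OF y] commute[of y "f x"] by (simp add: h_def)
    next
      case 3
      then show ?thesis using y r by (simp add: h_def)
    qed
  qed
  have surj: "\<exists>z\<in>M. h z = y" if y: "y \<in> M" for y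
  proof -
    consider "d (f x) y < r" | "d x y < r" "\<not> d (f x) y < r" | "\<not> d x y < r" "\<not> d (f x) y < r"
      by blast
    then show ?thesis
    proof cases
      case 1
      then have "h (g y) = y"
        using g_ball[OF y] fg[OF y] by (simp add: h_def)
      then show ?thesis using gM[OF y] by blast
    next
      case 2
      \<comment> \<open>The point \<open>f y\<close> lies in the ball around \<open>f x\<close>. If
        it were also in the ball around \<open>x\<close>, the balls would coincide, yet
        \<open>y\<close> lies in only one of them. So \<open>h\<close> acts on \<open>f y\<close> by
        \<open>g\<close>.\<close>
      then have "\<not> d x (f y) < r"
        using balls_eq[OF y fM[OF y]] f_ball[OF y] by auto
      then have "h (f y) = y"
        using 2 f_ball[OF y] gf[OF y] by (simp add: h_def)
      then show ?thesis using fM[OF y] by blast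
    next
      case 3
      then have "h y = y" by (simp add: h_def)
      then show ?thesis using y by blast
    qed
  qed
  have iso_aux: "d (h y) (h z) = d y z"
    if y: "y \<in> M" and z: "z \<in> M" and far: "r \<le> d y z" "r \<le> d (h y) (h z)" for y z
  proof (rule antisym)
    show "d (h y) (h z) \<le> d y z"
      using dist_le_of_displacement_le y z hM displacement far by blast
    show "d y z \<le> d (h y) (h z)"
      using dist_le_of_displacement_le[of "h y" "h z" y z r] y z hM displacement far commute
      by metis
  qed
  have h_ball: "d (f x) (h y) < r" if "y \<in> M" "d x y < r" for y
    using that f_ball by (simp add: h_def)
  have h_ball': "d x (h y) < r \<and> \<not> d (f x) (h y) < r"
    if "y \<in> M" "\<not> d x y < r" "d (f x) y < r" for y
    using that g_ball[of y] balls_eq[OF that(1) gM[OF that(1)]] by (auto simp: h_def)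
  have h_out: "h y = y" if "\<not> d x y < r" "\<not> d (f x) y < r" for y
    using that by (simp add: h_def)
  have far: "r \<le> d y z" if "y \<in> M" "z \<in> M" "c \<in> M" "d c y < r" "\<not> d c z < r" for c y z
    using that dist_less_trans[of c y r z] by linarith
  have iso_sep: "d (h y) (h z) = d y z"
    if y: "y \<in> M" and z: "z \<in> M" and 1: "d x y < r" and 2: "\<not> d x z < r" for y z
  proof (rule iso_aux[OF y z])
    show "r \<le> d y z" using far y z x 1 2 by blast
    \<comment> \<open>The ball around \<open>f x\<close> separates the images: it receives
      \<open>h y\<close>, while a point outside the ball around \<open>x\<close> is either sent out
      of it or was never in it.\<close>
    have "\<not> d (f x) (h z) < r" using h_ball' h_out z 2 by metis
    then show "r \<le> d (h y) (h z)"
      using far[OF hM[OF y] hM[OF z] fx] h_ball[OF y 1] by blast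
  qed
  have iso_sep': "d (h y) (h z) = d y z"
    if y: "y \<in> M" and z: "z \<in> M" and 1: "\<not> d x y < r" "d (f x) y < r"
      and 2: "\<not> d x z < r" "\<not> d (f x) z < r" for y z
  proof (rule iso_aux[OF y z])
    show "r \<le> d y z" using far y z fx 1 2 by blast
    \<comment> \<open>Here the ball around \<open>x\<close> separates the images: \<open>h y\<close>
      has moved into it and \<open>h z = z\<close> stays outside.\<close>
    show "r \<le> d (h y) (h z)"
      using far[OF hM[OF y] hM[OF z] x] h_ball'[OF y 1] h_out[OF 2] 2 by simp
  qed
  have iso: "d (h y) (h z) = d y z" if y: "y \<in> M" and z: "z \<in> M" for y z
  proof (cases "d x y < r \<longleftrightarrow> d x z < r")
    case False
    then show ?thesis using iso_sep y z commute by metis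
  next
    case eq: True
    show ?thesis
    \<comment> \<open>In the true case both points fall under the same branch of \<open>h\<close>,
      so a single isometry acts on both.\<close>
    proof (cases "d x y < r \<or> (d (f x) y < r \<longleftrightarrow> d (f x) z < r)")
      case True
      then show ?thesis using eq fd gd y z by (auto simp: h_def)
    next
      case False
      then show ?thesis using eq iso_sep' y z commute by metis
    qed
  qed
  show thesis
  proof
    have "h ` M = M" using hM surj by blast
    then show "surjective_isometry M d h"
      using iso by (simp add: surjective_isometry_def)
    show "h x = f x" using x r by (simp add: h_def)
    show "h y = y" if "r \<le> d x y" "r \<le> d (f x) y" for y
      using that by (simp add: h_def)
  qed
qed

lemma extends_of_extends_pairs:
  assumes "finite F" and "F \<subseteq> M"
    and "\<forall>x\<in>F. \<forall>y\<in>F. extends_to_surjective_isometry M d {x, y} \<phi>"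
  shows "extends_to_surjective_isometry M d F \<phi>"
  using assms
proof (induction F)
  case empty
  have "surjective_isometry M d id" by (simp add: surjective_isometry_def)
  then show ?case by (auto simp: extends_to_surjective_isometry_def)
next
  case (insert x G)
  then have x: "x \<in> M" and G: "G \<subseteq> M" by auto
  show ?case
  proof (cases "G = {}")
    case True
    \<comment> \<open>The hypothesis for the degenerate pair \<open>{x, x}\<close> is exactly the
      claim.\<close>
    then show ?thesis using insert.prems by auto
  next
    case False
    obtain \<psi> where \<psi>: "surjective_isometry M d \<psi>" and \<psi>_G: "\<And>y. y \<in> G \<Longrightarrow> \<psi> y = \<phi> y"
      using insert by (auto simp: extends_to_surjective_isometry_def)
    obtain \<tau> where \<tau>: "surjective_isometry M d \<tau>"
      and \<tau>\<psi>: "\<And>y. y \<in> M \<Longrightarrow> \<tau> (\<psi> y) = y" and \<psi>\<tau>: "\<And>y. y \<in> M \<Longrightarrow> \<psi> (\<tau> y) = y"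
      using surjective_isometry_inverse[OF \<psi>] by blast
    have pair: "\<exists>f. surjective_isometry M d f \<and> f x = \<tau> (\<phi> x) \<and> f y = y" if y: "y \<in> G" for y
    proof -
      obtain \<rho> where "surjective_isometry M d \<rho>" "\<rho> x = \<phi> x" "\<rho> y = \<phi> y"
        using insert.prems y by (auto simp: extends_to_surjective_isometry_def)
      moreover have "\<tau> (\<phi> y) = y"
        using \<tau>\<psi>[of y] \<psi>_G[OF y] y G by auto
      ultimately show ?thesis
        using surjective_isometry_comp[OF \<tau>] by (intro exI[of _ "\<tau> \<circ> \<rho>"]) simp
    qed
    \<comment> \<open>The isometry from \<open>pair\<close> fixes \<open>y\<close> and carries
      \<open>x\<close> to \<open>\<tau> (\<phi> x)\<close>.\<close>
    have same_dist: "d (\<tau> (\<phi> x)) y = d x y" if "y \<in> G" for y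
      using pair[OF that] that x G surjective_isometry_dist by (metis subsetD)
    obtain g where g: "g \<in> G" and g_min: "\<And>y. y \<in> G \<Longrightarrow> d x g \<le> d x y"
      using ex_min_if_finite[of "d x ` G"] insert.hyps(1) False by (force simp: not_less)
    obtain f where f: "surjective_isometry M d f" and f_x: "f x = \<tau> (\<phi> x)"
      using pair[OF g] by blast
    have "0 < d x g"
      using x g G insert.hyps(2) by (metis mdist_pos_less subsetD)
    moreover have "d x (f x) \<le> d x g"
      using ultrametric[of x g "f x"] x g G same_dist[OF g] commute[of g "f x"] f_x
        surjective_isometry_mem[OF f x] by auto
    ultimately obtain h where h: "surjective_isometry M d h" and h_x: "h x = f x"
      and h_far: "\<And>y. d x g \<le> d x y \<Longrightarrow> d x g \<le> d (f x) y \<Longrightarrow> h y = y"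
      using surjective_isometry_moving_balls[OF f x] by metis
    \<comment> \<open>By minimality of \<open>d x g\<close> and by \<open>same_dist\<close>,
      \<open>y\<close> lies outside both open balls of radius \<open>d x g\<close>.\<close>
    have "h y = y" if "y \<in> G" for y
      using h_far g_min[OF that] same_dist[OF that] f_x by simp
    \<comment> \<open>Membership lets \<open>\<psi>\<close> cancel \<open>\<tau>\<close> at
      \<open>\<phi> x\<close>; it holds since some isometry of \<open>M\<close> agrees with
      \<open>\<phi>\<close> at \<open>x\<close>.\<close>
    moreover have "\<phi> x \<in> M"
      using insert.prems x surjective_isometry_mem
      by (metis extends_to_surjective_isometry_def insertI1)
    ultimately have "\<forall>y\<in>insert x G. (\<psi> \<circ> h) y = \<phi> y"
      using \<psi>_G \<psi>\<tau> h_x f_x by simp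
    then show ?thesis
      using surjective_isometry_comp[OF \<psi> h]
      unfolding extends_to_surjective_isometry_def by blast
  qed
qed

end

theorem corollary1:
  fixes M :: "'a set" and d :: "'a \<Rightarrow> 'a \<Rightarrow> real"
    and n :: nat and F F' :: "'a set" and \<phi> :: "'a \<Rightarrow> 'a"
  assumes "Ultrametric_space M d"
    and "F \<subseteq> M" and "finite F" and "card F = n"
    and "F' \<subseteq> M" and "finite F'" and "card F' = n"
    and "\<phi> \<in> F \<rightarrow> F'"
  shows "extends_to_surjective_isometry M d F \<phi> \<longleftrightarrow>
    (\<forall>x\<in>F. \<forall>y\<in>F. extends_to_surjective_isometry M d {x, y} \<phi>)"
proof
  assume "extends_to_surjective_isometry M d F \<phi>"
  then show "\<forall>x\<in>F. \<forall>y\<in>F. extends_to_surjective_isometry M d {x, y} \<phi>"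
    unfolding extends_to_surjective_isometry_def by blast
next
  assume "\<forall>x\<in>F. \<forall>y\<in>F. extends_to_surjective_isometry M d {x, y} \<phi>"
  then show "extends_to_surjective_isometry M d F \<phi>"
    using Ultrametric_space.extends_of_extends_pairs assms(1-3) by blast
qed

end
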